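(* Every countable subgroup $G$ of the additive group $\mathbb{R}^\omega$ is compactly generated.
   Context: $\mathbb{R}^\omega$ is the countably infinite product of copies of the real line, with coordinatewise addition and the product topology. A subgroup $G$ of a topological group is compactly generated if there is a compact set $C\subseteq G$ such that $G$ is the subgroup generated by $C$. *)

theory Defs
  imports "HOL-Analysis.Analysis" "HOL-Algebra.Product_Groups" "HOL-Algebra.Generated_Groups"
begin

definition real_line_group :: "real monoid" where
  "real_line_group = \<lparr>carrier = UNIV, monoid.mult = (+), one = 0\<rparr>"

definition R_omega_group :: "(nat \<Rightarrow> real) monoid" where
  "R_omega_group = product_group UNIV (\<lambda>_::nat. real_line_group)"

definition R_omega_topology :: "(nat \<Rightarrow> real) topology" where
  "R_omega_topology = product_topology (\<lambda>_::nat. euclideanreal) UNIV"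

(* The group and the topology on the ambient topological group are passed separately.
   Compactness of C does not depend on whether C is regarded as a subspace of the
   ambient space or of G. *)
definition compactly_generated :: "('a, 'b) monoid_scheme \<Rightarrow> 'a topology \<Rightarrow> 'a set \<Rightarrow> bool" where
  "compactly_generated \<Gamma> T G \<longleftrightarrow> (\<exists>C. compactin T C \<and> C \<subseteq> G \<and> generate \<Gamma> C = G)"

lemma R_omega_carrier [simp]: "carrier R_omega_group = UNIV"
  by (simp add: R_omega_group_def product_group_def real_line_group_def)

lemma R_omega_mult [simp]: "x \<otimes>\<^bsub>R_omega_group\<^esub> y = (\<lambda>n. x n + y n)"
  by (simp add: R_omega_group_def product_group_def real_line_group_def restrict_def)

lemma R_omega_one [simp]: "\<one>\<^bsub>R_omega_group\<^esub> = (\<lambda>_. 0)"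
  by (simp add: R_omega_group_def product_group_def real_line_group_def restrict_def)

lemma comm_group_R_omega: "comm_group R_omega_group"
proof (rule comm_groupI)
  fix x :: "nat \<Rightarrow> real"
  show "\<exists>y\<in>carrier R_omega_group. y \<otimes>\<^bsub>R_omega_group\<^esub> x = \<one>\<^bsub>R_omega_group\<^esub>"
    by (rule bexI[of _ "\<lambda>n. - x n"]) auto
qed (auto simp: add_ac)

lemma R_omega_inv [simp]: "inv\<^bsub>R_omega_group\<^esub> x = (\<lambda>n. - x n)"
proof -
  interpret comm_group R_omega_group by (rule comm_group_R_omega)
  show ?thesis by (rule inv_equality) auto
qed

lemma topspace_R_omega [simp]: "topspace R_omega_topology = UNIV"
  by (simp add: R_omega_topology_def)

lemma continuous_map_R_omega_mult:
  "continuous_map (prod_topology R_omega_topology R_omega_topology) R_omega_topology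
     (\<lambda>(x, y). x \<otimes>\<^bsub>R_omega_group\<^esub> y)"
proof -
  have proj: "continuous_map R_omega_topology euclideanreal (\<lambda>x. x n)" for n
    unfolding R_omega_topology_def by (rule continuous_map_product_projection) simp
  have "continuous_map (prod_topology R_omega_topology R_omega_topology) euclideanreal
     (\<lambda>p. fst p n + snd p n)" for n
    using continuous_map_compose[OF continuous_map_fst proj]
          continuous_map_compose[OF continuous_map_snd proj]
    by (intro continuous_map_add) (auto simp: o_def)
  then show ?thesis
    by (subst (3) R_omega_topology_def) (simp add: continuous_map_componentwise_UNIV case_prod_unfold)
qed

lemma continuous_map_R_omega_inv:
  "continuous_map R_omega_topology R_omega_topology (\<lambda>x. inv\<^bsub>R_omega_group\<^esub> x)"
proof -
  have "continuous_map R_omega_topology euclideanreal (\<lambda>x. - x n)" for n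
    unfolding R_omega_topology_def
    by (intro continuous_map_minus continuous_map_product_projection) simp
  then show ?thesis
    by (subst (2) R_omega_topology_def) (simp add: continuous_map_componentwise_UNIV)
qed

end

theory Submission
  imports Defs
begin

text \<open>
  A subgroup of \<open>\<real>\<^sup>\<omega>\<close> is finitely generated modulo the elements whose first \<open>n\<close> coordinates are
  small: it is finitely generated modulo elements that are bounded there (remove one coordinate at
  a time by projecting along an element of the group), and bounded sets in \<open>\<real>\<^sup>n\<close> are totally
  bounded. Let \<open>W n\<close> consist of the elements of \<open>G\<close> whose first \<open>n\<close> coordinates are at most
  \<open>1 / (n + 1)\<close> in absolute value. Applied to the subgroup generated by \<open>W n\<close>, this gives finite
  sets \<open>K n \<subseteq> W n\<close> such that \<open>K n\<close> and \<open>W (n + 1)\<close> together generate \<open>W n\<close>. Hence the \<open>n\<close>-th element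
  of \<open>G\<close> is generated by \<open>K 0, \<dots>, K (n - 1)\<close> and finitely many elements of \<open>W n\<close>. The finite sets
  chosen in this way shrink to \<open>0\<close>, so together with \<open>0\<close> they form a compact generating set.
\<close>

section \<open>Subgroups of \<open>R_omega_group\<close> and finite generating subsets\<close>

interpretation R_omega: comm_group R_omega_group
  by (rule comm_group_R_omega)

lemma subgroup_R_omega_add:
  assumes "subgroup H R_omega_group" "x \<in> H" "y \<in> H"
  shows "(\<lambda>i. x i + y i) \<in> H"
  using subgroup.m_closed[OF assms] by simp

lemma subgroup_R_omega_diff:
  assumes "subgroup H R_omega_group" "x \<in> H" "y \<in> H"
  shows "(\<lambda>i. x i - y i) \<in> H"
  using subgroup.m_closed[OF assms(1,2) subgroup.m_inv_closed[OF assms(1,3)]] by simp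

lemma subgroup_R_omega_scale_int:
  assumes H: "subgroup H R_omega_group" and x: "x \<in> H"
  shows "(\<lambda>i. of_int k * x i) \<in> H"
proof (induction k rule: int_induct[where k = 0])
  case base
  show ?case using subgroup.one_closed[OF H] by simp
next
  case (step1 k)
  from subgroup_R_omega_add[OF H step1.IH x] show ?case by (simp add: algebra_simps)
next
  case (step2 k)
  from subgroup_R_omega_diff[OF H step2.IH x] show ?case by (simp add: algebra_simps)
qed

lemma subgroup_generate_R_omega: "subgroup (generate R_omega_group A) R_omega_group"
  by (rule R_omega.generate_is_subgroup) simp

lemma (in group) finite_generating_subset:
  assumes "x \<in> generate G A"
  shows "\<exists>B. finite B \<and> B \<subseteq> A \<and> x \<in> generate G B"
  using assms
proof induction
  case one
  show ?case by (intro exI[of _ "{}"]) (auto intro: generate.one)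
next
  case (incl h)
  then show ?case by (intro exI[of _ "{h}"]) (auto intro: generate.incl)
next
  case (inv h)
  then show ?case by (intro exI[of _ "{h}"]) (auto intro: generate.inv)
next
  case (eng h1 h2)
  then obtain B1 B2 where B: "finite B1" "B1 \<subseteq> A" "h1 \<in> generate G B1"
    "finite B2" "B2 \<subseteq> A" "h2 \<in> generate G B2" by blast
  then have "h1 \<in> generate G (B1 \<union> B2)" "h2 \<in> generate G (B1 \<union> B2)"
    using mono_generate[of B1 "B1 \<union> B2"] mono_generate[of B2 "B1 \<union> B2"] by auto
  then show ?case
    using B by (intro exI[of _ "B1 \<union> B2"]) (auto intro: generate.eng)
qed

lemma (in group) finite_generating_subset_finite:
  assumes "finite F" "F \<subseteq> generate G A"
  shows "\<exists>B. finite B \<and> B \<subseteq> A \<and> F \<subseteq> generate G B"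
proof -
  have "\<forall>x\<in>F. \<exists>B. finite B \<and> B \<subseteq> A \<and> x \<in> generate G B"
    using assms finite_generating_subset by blast
  then obtain B where B: "\<forall>x\<in>F. finite (B x) \<and> B x \<subseteq> A \<and> x \<in> generate G (B x)"
    by metis
  have "F \<subseteq> generate G (\<Union>(B ` F))"
    using B mono_generate[of "B _" "\<Union>(B ` F)"] by blast
  then show ?thesis
    using B assms by (intro exI[of _ "\<Union>(B ` F)"]) auto
qed

section \<open>Finite generation modulo bounded and modulo small elements\<close>

lemma subgroup_finitely_generated_mod_bounded:
  assumes "subgroup G R_omega_group"
  shows "\<exists>F M. finite F \<and> F \<subseteq> G \<and>
    (\<forall>x\<in>G. \<exists>f\<in>generate R_omega_group F. \<forall>i<n. \<bar>x i - f i\<bar> \<le> M)"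
  using assms
proof (induction n arbitrary: G)
  case 0
  show ?case
    by (intro exI[of _ "{}"]) (auto intro: generate.one)
next
  case (Suc n)
  show ?case
  proof (cases "\<forall>x\<in>G. x n = 0")
    case True
    from Suc.IH[OF Suc.prems] obtain F M where F: "finite F" "F \<subseteq> G"
      and M: "\<forall>x\<in>G. \<exists>f\<in>generate R_omega_group F. \<forall>i<n. \<bar>x i - f i\<bar> \<le> M" by blast
    have gen: "generate R_omega_group F \<subseteq> G"
      by (rule R_omega.generate_subgroup_incl[OF F(2) Suc.prems])
    have "\<bar>x n - f n\<bar> = 0" if "x \<in> G" "f \<in> generate R_omega_group F" for x f
      using bspec[OF True that(1)] bspec[OF True subsetD[OF gen that(2)]] by simp
    \<comment> \<open>For \<open>n = 0\<close> the bound \<open>M\<close> is unconstrained and may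
      be negative; coordinate \<open>n\<close> needs a bound of at least 0.\<close>
    then have "\<forall>x\<in>G. \<exists>f\<in>generate R_omega_group F. \<forall>i<Suc n. \<bar>x i - f i\<bar> \<le> max M 0"
      using M unfolding less_Suc_eq le_max_iff_disj by (metis order_refl)
    with F show ?thesis by blast
  next
    case False
    then obtain g where g: "g \<in> G" "g n \<noteq> 0" by blast
    \<comment> \<open>The projection along \<open>g\<close> that kills coordinate \<open>n\<close>.\<close>
    define \<phi> where "\<phi> x = (\<lambda>i. x i - x n / g n * g i)" for x :: "nat \<Rightarrow> real"
    have \<phi>_add: "\<phi> (\<lambda>i. x i + y i) = (\<lambda>i. \<phi> x i + \<phi> y i)" for x y
      by (rule ext) (simp add: \<phi>_def algebra_simps add_divide_distrib)
    have hom: "group_hom R_omega_group R_omega_group \<phi>"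
      by unfold_locales (simp add: hom_def \<phi>_add)
    \<comment> \<open>The image of \<open>G\<close> need not lie in \<open>G\<close>, so the
      induction ranges over all subgroups, and the generators \<open>F'\<close> of the image are
      pulled back to \<open>F\<close> in \<open>G\<close>.\<close>
    have "subgroup (\<phi> ` G) R_omega_group"
      by (rule group_hom.subgroup_img_is_subgroup[OF hom Suc.prems])
    from Suc.IH[OF this] obtain F' M where F': "finite F'" "F' \<subseteq> \<phi> ` G"
      and M: "\<forall>x\<in>\<phi> ` G. \<exists>f\<in>generate R_omega_group F'. \<forall>i<n. \<bar>x i - f i\<bar> \<le> M" by blast
    from finite_subset_image[OF F'] obtain F where F: "F \<subseteq> G" "finite F" "F' = \<phi> ` F" by blast
    let ?S = "generate R_omega_group (insert g F)"
    have S: "subgroup ?S R_omega_group" by (rule subgroup_generate_R_omega)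
    have "generate R_omega_group F' = \<phi> ` generate R_omega_group F"
      unfolding F(3) by (rule group_hom.generate_img[OF hom]) simp
    moreover have "generate R_omega_group F \<subseteq> ?S"
      by (rule R_omega.mono_generate) auto
    ultimately have lift: "generate R_omega_group F' \<subseteq> \<phi> ` ?S" by blast
    \<comment> \<open>The first summand bounds the projected difference, the second any multiple of
      \<open>g\<close> with factor in [0,1), on coordinates up to \<open>n\<close>.\<close>
    define N where "N = \<bar>M\<bar> + (\<Sum>i\<le>n. \<bar>g i\<bar>)"
    have "\<exists>f\<in>?S. \<forall>i<Suc n. \<bar>x i - f i\<bar> \<le> N" if x: "x \<in> G" for x
    proof -
      from M x lift obtain f where f: "f \<in> ?S" "\<forall>i<n. \<bar>\<phi> x i - \<phi> f i\<bar> \<le> M" by blast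
      \<comment> \<open>Subtracting \<open>t\<close> times \<open>g\<close> from
        \<open>x - f\<close> gives exactly \<open>\<phi> x - \<phi> f\<close>. Only integer
        multiples of \<open>g\<close> stay in the subgroup, so \<open>t\<close> is rounded down, at
        the cost of \<open>frac t\<close> times \<open>g\<close>.\<close>
      define t where "t = (x n - f n) / g n"
      have "g \<in> ?S" by (rule generate.incl) simp
      then have mem: "(\<lambda>i. f i + of_int \<lfloor>t\<rfloor> * g i) \<in> ?S"
        by (intro subgroup_R_omega_add[OF S f(1)] subgroup_R_omega_scale_int[OF S])
      have "\<bar>x i - (f i + of_int \<lfloor>t\<rfloor> * g i)\<bar> \<le> N" if "i < Suc n" for i
      proof -
        have eq: "x i - (f i + of_int \<lfloor>t\<rfloor> * g i) = (\<phi> x i - \<phi> f i) + frac t * g i"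
          unfolding frac_def t_def \<phi>_def by (simp add: algebra_simps diff_divide_distrib)
        have "\<bar>\<phi> x i - \<phi> f i\<bar> \<le> \<bar>M\<bar>"
        proof (cases "i = n")
          case True
          then show ?thesis using g by (simp add: \<phi>_def)
        next
          case False
          then have "i < n" using that by simp
          with f(2) have "\<bar>\<phi> x i - \<phi> f i\<bar> \<le> M" by blast
          then show ?thesis by linarith
        qed
        moreover have "\<bar>frac t * g i\<bar> \<le> 1 * \<bar>g i\<bar>"
          unfolding abs_mult by (intro mult_right_mono) (auto simp: frac_lt_1 less_imp_le)
        moreover have "\<bar>g i\<bar> \<le> (\<Sum>i\<le>n. \<bar>g i\<bar>)"
          using that by (intro member_le_sum) auto
        ultimately show ?thesis unfolding eq N_def by linarith
      qed
      then show ?thesis by (intro bexI[OF _ mem]) simp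
    qed
    then show ?thesis
      using F g by (intro exI[of _ "insert g F"] exI[of _ N]) auto
  qed
qed

text \<open>Pigeonhole on a grid of mesh \<open>\<epsilon>\<close>: boundedness leaves finitely many
  occupied cells, and one point of \<open>B\<close> is chosen from each. Taking the net inside
  \<open>B\<close> later keeps it inside the group.\<close>

lemma finite_net_of_bounded_coordinates:
  fixes B :: "(nat \<Rightarrow> real) set"
  assumes "0 < \<epsilon>" and B: "\<And>b i. b \<in> B \<Longrightarrow> i < n \<Longrightarrow> \<bar>b i\<bar> \<le> M"
  shows "\<exists>K. finite K \<and> K \<subseteq> B \<and> (\<forall>b\<in>B. \<exists>k\<in>K. \<forall>i<n. \<bar>b i - k i\<bar> \<le> \<epsilon>)"
proof -
  \<comment> \<open>The restriction to \<open>{..<n}\<close> puts the cells into a finite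
    extensional function space.\<close>
  define cell where "cell b = (\<lambda>i\<in>{..<n}. \<lfloor>b i / \<epsilon>\<rfloor>)" for b :: "nat \<Rightarrow> real"
  have "cell b \<in> {..<n} \<rightarrow>\<^sub>E {\<lfloor>- M / \<epsilon>\<rfloor>..\<lfloor>M / \<epsilon>\<rfloor>}" if "b \<in> B" for b
  proof -
    have "- M / \<epsilon> \<le> b i / \<epsilon> \<and> b i / \<epsilon> \<le> M / \<epsilon>" if "i < n" for i
      using B[OF \<open>b \<in> B\<close> that] \<open>0 < \<epsilon>\<close> by (intro conjI divide_right_mono) auto
    then show ?thesis
      by (auto simp: cell_def intro!: floor_mono)
  qed
  then have "finite (cell ` B)"
    by (intro finite_subset[OF _ finite_PiE[of "{..<n}" "\<lambda>_. {\<lfloor>- M / \<epsilon>\<rfloor>..\<lfloor>M / \<epsilon>\<rfloor>}"]]) auto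
  from finite_subset_image[OF this order_refl]
  obtain K where K: "K \<subseteq> B" "finite K" "cell ` B = cell ` K" by blast
  have "\<exists>k\<in>K. \<forall>i<n. \<bar>b i - k i\<bar> \<le> \<epsilon>" if "b \<in> B" for b
  proof -
    from K that obtain k where k: "k \<in> K" "cell b = cell k" by blast
    have "\<bar>b i - k i\<bar> \<le> \<epsilon>" if "i < n" for i
    proof -
      have "\<lfloor>b i / \<epsilon>\<rfloor> = \<lfloor>k i / \<epsilon>\<rfloor>"
        using fun_cong[OF k(2), of i] that by (simp add: cell_def)
      then have "\<bar>b i / \<epsilon> - k i / \<epsilon>\<bar> \<le> 1" by linarith
      then have "\<bar>(b i - k i) / \<epsilon>\<bar> \<le> 1" by (simp add: diff_divide_distrib)
      then show ?thesis using \<open>0 < \<epsilon>\<close> by (simp add: abs_divide)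
    qed
    then show ?thesis using k by blast
  qed
  then show ?thesis using K by blast
qed

text \<open>Each \<open>x\<close> splits as \<open>f + k + w\<close>: \<open>f\<close> approximates
  \<open>x\<close> up to a bounded remainder, \<open>k\<close> is a net point near that remainder,
  and \<open>w\<close> is the small rest, which lies in \<open>G\<close> as a difference of elements
  of \<open>G\<close>.\<close>

lemma subgroup_finitely_generated_mod_small:
  assumes G: "subgroup G R_omega_group" and "0 < \<epsilon>"
  shows "\<exists>F. finite F \<and> F \<subseteq> G \<and>
    G \<subseteq> generate R_omega_group (F \<union> {x \<in> G. \<forall>i<n. \<bar>x i\<bar> \<le> \<epsilon>})"
proof -
  from subgroup_finitely_generated_mod_bounded[OF G, of n] obtain F M
    where F: "finite F" "F \<subseteq> G"
      and M: "\<forall>x\<in>G. \<exists>f\<in>generate R_omega_group F. \<forall>i<n. \<bar>x i - f i\<bar> \<le> M" by blast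
  define B where "B = {x \<in> G. \<forall>i<n. \<bar>x i\<bar> \<le> M}"
  obtain K where K: "finite K" "K \<subseteq> B" "\<forall>b\<in>B. \<exists>k\<in>K. \<forall>i<n. \<bar>b i - k i\<bar> \<le> \<epsilon>"
    using finite_net_of_bounded_coordinates[OF \<open>0 < \<epsilon>\<close>, of B n M] by (auto simp: B_def)
  let ?W = "{x \<in> G. \<forall>i<n. \<bar>x i\<bar> \<le> \<epsilon>}"
  let ?S = "generate R_omega_group ((F \<union> K) \<union> ?W)"
  have S: "subgroup ?S R_omega_group" by (rule subgroup_generate_R_omega)
  have FG: "generate R_omega_group F \<subseteq> G"
    by (rule R_omega.generate_subgroup_incl[OF F(2) G])
  have FS: "generate R_omega_group F \<subseteq> ?S"
    by (rule R_omega.mono_generate) auto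
  have "x \<in> ?S" if x: "x \<in> G" for x
  proof -
    from M x obtain f where f: "f \<in> generate R_omega_group F" "\<forall>i<n. \<bar>x i - f i\<bar> \<le> M" by blast
    define b where "b = (\<lambda>i. x i - f i)"
    have b: "b \<in> B"
      using f FG x subgroup_R_omega_diff[OF G] by (auto simp: B_def b_def)
    with K obtain k where k: "k \<in> K" "\<forall>i<n. \<bar>b i - k i\<bar> \<le> \<epsilon>" by blast
    have w: "(\<lambda>i. b i - k i) \<in> ?W"
      using b k K(2) subgroup_R_omega_diff[OF G, of b k] by (auto simp: B_def)
    have "f \<in> ?S" using f FS by blast
    moreover have "k \<in> ?S" by (rule generate.incl) (use k in blast)
    moreover have "(\<lambda>i. b i - k i) \<in> ?S" by (rule generate.incl) (use w in blast)
    ultimately have "(\<lambda>i. f i + (k i + (b i - k i))) \<in> ?S"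
      by (intro subgroup_R_omega_add[OF S])
    then show ?thesis by (simp add: b_def)
  qed
  then show ?thesis
    using F K by (intro exI[of _ "F \<union> K"]) (auto simp: B_def)
qed

section \<open>Shrinking neighbourhoods of zero and compactness\<close>

text \<open>One index governs both how many coordinates are constrained and how strongly, which
  gives a decreasing neighbourhood base at 0 starting with the whole space.\<close>

definition small :: "nat \<Rightarrow> (nat \<Rightarrow> real) set" where
  "small n = {x. \<forall>i<n. \<bar>x i\<bar> \<le> 1 / real (Suc n)}"

lemma small_antimono: "m \<le> n \<Longrightarrow> small n \<subseteq> small m"
proof
  fix x assume "m \<le> n" "x \<in> small n"
  moreover have "1 / real (Suc n) \<le> 1 / real (Suc m)"
    using \<open>m \<le> n\<close> by (intro divide_left_mono) auto
  ultimately show "x \<in> small m"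
    unfolding small_def by (auto intro!: order_trans[of _ "1 / (1 + real n)" "1 / (1 + real m)"])
qed

lemma small_nhds_base:
  assumes "openin R_omega_topology U" "(\<lambda>_. 0) \<in> U"
  shows "\<exists>n. small n \<subseteq> U"
proof -
  from product_topology_open_contains_basis[OF assms[unfolded R_omega_topology_def]]
  obtain X where X: "(\<lambda>_. 0) \<in> PiE UNIV X" "\<And>i. open (X i)"
    "finite {i. X i \<noteq> UNIV}" "PiE UNIV X \<subseteq> U" by auto
  \<comment> \<open>A basic open box restricts finitely many coordinates, so conditions that hold
    eventually for each of them hold for a common \<open>n\<close>.\<close>
  have "\<forall>\<^sub>F n in sequentially. i < n \<and> cball 0 (1 / real (Suc n)) \<subseteq> X i" for i
  proof -
    have "0 \<in> X i" using X(1) by auto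
    with X(2)[of i] obtain e where e: "e > 0" "cball 0 e \<subseteq> X i"
      using open_contains_cball by blast
    have "\<forall>\<^sub>F n in sequentially. 1 / real (Suc n) < e"
      by (rule order_tendstoD(2)[OF LIMSEQ_Suc[OF lim_1_over_n] e(1)])
    then have "\<forall>\<^sub>F n in sequentially. cball 0 (1 / real (Suc n)) \<subseteq> X i"
      by (rule eventually_mono) (use e(2) in force)
    then show ?thesis
      using eventually_gt_at_top[of i] by (rule eventually_conj[rotated])
  qed
  then have "\<forall>\<^sub>F n in sequentially. \<forall>i\<in>{i. X i \<noteq> UNIV}. i < n \<and> cball 0 (1 / real (Suc n)) \<subseteq> X i"
    by (intro eventually_ball_finite[OF X(3)]) blast
  then obtain n where n: "\<forall>i\<in>{i. X i \<noteq> UNIV}. i < n \<and> cball 0 (1 / real (Suc n)) \<subseteq> X i"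
    using eventually_happens'[OF sequentially_bot] by blast
  have "x i \<in> X i" if "x \<in> small n" for x i
  proof (cases "X i = UNIV")
    case False
    then have "i < n" "cball 0 (1 / real (Suc n)) \<subseteq> X i" using n by auto
    moreover have "x i \<in> cball 0 (1 / real (Suc n))"
      using that \<open>i < n\<close> by (simp add: small_def)
    ultimately show ?thesis by blast
  qed simp
  then show ?thesis using X(4) by (intro exI[of _ n]) (auto simp: PiE_UNIV_domain)
qed

text \<open>A cover member containing 0 contains some \<open>small n\<close>, hence every
  \<open>D m\<close> with \<open>m \<ge> n\<close>; the earlier sets have only finitely many points
  in total.\<close>

lemma compactin_null_sequence_of_finite_sets:
  assumes D: "\<And>n. finite (D n)" "\<And>n. D n \<subseteq> small n"
  shows "compactin R_omega_topology (insert (\<lambda>_. 0) (\<Union>n. D n))"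
  unfolding compactin_def
proof (intro conjI allI impI)
  fix \<U> assume "Ball \<U> (openin R_omega_topology) \<and> insert (\<lambda>_. 0) (\<Union>n. D n) \<subseteq> \<Union>\<U>"
  then have \<U>: "\<And>U. U \<in> \<U> \<Longrightarrow> openin R_omega_topology U" "(\<lambda>_. 0) \<in> \<Union>\<U>" "(\<Union>n. D n) \<subseteq> \<Union>\<U>"
    by auto
  then obtain U n where U: "U \<in> \<U>" "(\<lambda>_. 0) \<in> U" "small n \<subseteq> U"
    using small_nhds_base by blast
  have fin: "finite (\<Union>m<n. D m)" using D by simp
  have "(\<Union>m<n. D m) \<subseteq> \<Union>\<U>" using \<U> by blast
  from finite_subset_Union[OF fin this]
  obtain \<F> where \<F>: "finite \<F>" "\<F> \<subseteq> \<U>" "(\<Union>m<n. D m) \<subseteq> \<Union>\<F>" by blast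
  have "D m \<subseteq> U \<union> \<Union>\<F>" for m
    using D(2)[of m] small_antimono[of n m] U(3) \<F>(3) by (cases "m < n") auto
  then show "\<exists>\<F>. finite \<F> \<and> \<F> \<subseteq> \<U> \<and> insert (\<lambda>_. 0) (\<Union>n. D n) \<subseteq> \<Union>\<F>"
    using \<F> U by (intro exI[of _ "insert U \<F>"]) auto
qed simp

section \<open>The compact generating set\<close>

text \<open>As \<open>G \<inter> small n\<close> need not be a subgroup, the previous result is
  applied to the subgroup it generates. The resulting \<open>F\<close> may leave
  \<open>small n\<close>, so it is replaced by the finitely many elements of
  \<open>G \<inter> small n\<close> that express it.\<close>

lemma small_elements_finitely_generated_mod_smaller:
  assumes G: "subgroup G R_omega_group"
  shows "\<exists>K. finite K \<and> K \<subseteq> G \<inter> small n \<and>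
    G \<inter> small n \<subseteq> generate R_omega_group (K \<union> (G \<inter> small (Suc n)))"
proof -
  let ?H = "generate R_omega_group (G \<inter> small n)"
  let ?W = "{x \<in> ?H. \<forall>i<Suc n. \<bar>x i\<bar> \<le> 1 / real (Suc (Suc n))}"
  obtain F where F: "finite F" "F \<subseteq> ?H" "?H \<subseteq> generate R_omega_group (F \<union> ?W)"
    using subgroup_finitely_generated_mod_small[OF subgroup_generate_R_omega,
        of "1 / real (Suc (Suc n))" "G \<inter> small n" "Suc n"] by auto
  from R_omega.finite_generating_subset_finite[OF F(1,2)]
  obtain K where K: "finite K" "K \<subseteq> G \<inter> small n" "F \<subseteq> generate R_omega_group K" by blast
  let ?S = "generate R_omega_group (K \<union> (G \<inter> small (Suc n)))"
  have "?H \<subseteq> G"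
    by (rule R_omega.generate_subgroup_incl[OF _ G]) auto
  then have "?W \<subseteq> G \<inter> small (Suc n)"
    by (auto simp: small_def)
  then have "?W \<subseteq> ?S"
    by (blast intro: generate.incl)
  moreover have "generate R_omega_group K \<subseteq> ?S"
    by (rule R_omega.mono_generate) auto
  ultimately have "generate R_omega_group (F \<union> ?W) \<subseteq> ?S"
    using K(3) by (intro R_omega.generate_subgroup_incl subgroup_generate_R_omega) blast
  moreover have "G \<inter> small n \<subseteq> ?H"
    by (blast intro: generate.incl)
  ultimately show ?thesis using F(3) K by blast
qed

theorem theorem4:
  fixes G :: "(nat \<Rightarrow> real) set"
  assumes "subgroup G R_omega_group"
    and "countable G"
  shows "compactly_generated R_omega_group R_omega_topology G"
proof -
  let ?gen = "generate R_omega_group"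
  define W where "W n = G \<inter> small n" for n
  have "\<forall>n. \<exists>K. finite K \<and> K \<subseteq> W n \<and> W n \<subseteq> ?gen (K \<union> W (Suc n))"
    unfolding W_def using small_elements_finitely_generated_mod_smaller[OF assms(1)] by blast
  then obtain K where K: "\<And>n. finite (K n)" "\<And>n. K n \<subseteq> W n"
    "\<And>n. W n \<subseteq> ?gen (K n \<union> W (Suc n))" by metis
  have G_gen: "G \<subseteq> ?gen ((\<Union>m<n. K m) \<union> W n)" for n
  proof (induction n)
    case 0
    have "G \<subseteq> W 0" by (auto simp: W_def small_def)
    then show ?case by (auto intro: generate.incl)
  next
    case (Suc n)
    let ?S = "?gen ((\<Union>m<Suc n. K m) \<union> W (Suc n))"
    have "?gen (K n \<union> W (Suc n)) \<subseteq> ?S"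
      by (rule R_omega.mono_generate) auto
    then have "W n \<subseteq> ?S" using K(3)[of n] by blast
    moreover have "(\<Union>m<n. K m) \<subseteq> ?S"
      by (auto intro!: generate.incl simp: less_Suc_eq)
    ultimately have "?gen ((\<Union>m<n. K m) \<union> W n) \<subseteq> ?S"
      by (intro R_omega.generate_subgroup_incl subgroup_generate_R_omega) blast
    with Suc show ?case by blast
  qed
  have "G \<noteq> {}" using subgroup.one_closed[OF assms(1)] by blast
  \<comment> \<open>An enumeration possibly with repetitions, which also covers finite
    \<open>G\<close>.\<close>
  define g where "g = from_nat_into G"
  have g: "range g = G"
    unfolding g_def by (rule range_from_nat_into[OF \<open>G \<noteq> {}\<close> assms(2)])
  have "\<exists>L. finite L \<and> L \<subseteq> W n \<and> g n \<in> ?gen ((\<Union>m<n. K m) \<union> L)" for n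
  proof -
    have "g n \<in> ?gen ((\<Union>m<n. K m) \<union> W n)" using G_gen g by blast
    from R_omega.finite_generating_subset[OF this] obtain T
      where T: "finite T" "T \<subseteq> (\<Union>m<n. K m) \<union> W n" "g n \<in> ?gen T" by blast
    \<comment> \<open>The part of \<open>T\<close> outside \<open>W n\<close> already lies in the
      earlier \<open>K m\<close>, so \<open>L n\<close> can be taken as
      \<open>T \<inter> W n\<close>.\<close>
    have "?gen T \<subseteq> ?gen ((\<Union>m<n. K m) \<union> (T \<inter> W n))"
      using T(2) by (intro R_omega.mono_generate) auto
    then show ?thesis using T by (intro exI[of _ "T \<inter> W n"]) auto
  qed
  then obtain L where L: "\<And>n. finite (L n)" "\<And>n. L n \<subseteq> W n"
    "\<And>n. g n \<in> ?gen ((\<Union>m<n. K m) \<union> L n)" by metis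
  \<comment> \<open>Stage \<open>n\<close> contributes a finite subset of \<open>small n\<close>;
    the limit point 0 is added for compactness.\<close>
  define C where "C = insert (\<lambda>_. 0) (\<Union>n. K n \<union> L n)"
  have "compactin R_omega_topology C"
    unfolding C_def using K(1,2) L(1,2)
    by (intro compactin_null_sequence_of_finite_sets) (auto simp: W_def)
  moreover have CG: "C \<subseteq> G"
    using K(2) L(2) subgroup.one_closed[OF assms(1)] unfolding C_def W_def R_omega_one by blast
  moreover have "?gen C = G"
  proof
    show "?gen C \<subseteq> G"
      by (rule R_omega.generate_subgroup_incl[OF CG assms(1)])
    have "?gen ((\<Union>m<n. K m) \<union> L n) \<subseteq> ?gen C" for n
      by (rule R_omega.mono_generate) (auto simp: C_def)
    then show "G \<subseteq> ?gen C" using L(3) g by blast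
  qed
  ultimately show ?thesis unfolding compactly_generated_def by blast
qed

end
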